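(* Let $(z^k)_{k\ge0}$ be the sequence generated by the Explicit Fast OGDA algorithm described in the context. Then $(z^k)_{k\ge0}$ converges weakly to a solution of the equation $V(z)=0$.
   Context: $\mathcal H$ is a real Hilbert space, $V\colon\mathcal H\to\mathcal H$ is monotone ($\langle x-y,V(x)-V(y)\rangle\ge0$ for all $x,y\in\mathcal H$) and $L$-Lipschitz continuous with $L>0$, and $\mathcal Z:=\{z\in\mathcal H: V(z)=0\}$ is assumed nonempty. Explicit Fast OGDA algorithm: let $\alpha>2$, $z^0,z^1,\bar z^0\in\mathcal H$ and $0<s<\frac{1}{2L}$. For every $k\ge1$ set $$\bar z^k:=z^k+\Big(1-\frac{\alpha}{k+\alpha}\Big)(z^k-z^{k-1})-\frac{\alpha s}{2(k+\alpha)}V(\bar z^{k-1}),$$ $$z^{k+1}:=\bar z^k-\frac s2\Big(1+\frac{k}{k+\alpha}\Big)\big(V(\bar z^k)-V(\bar z^{k-1})\big).$$ *)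

theory Defs
  imports "HOL-Analysis.Analysis"
begin

definition monotone_operator :: "('a::real_inner \<Rightarrow> 'a) \<Rightarrow> bool" where
  "monotone_operator V \<longleftrightarrow> (\<forall>x y. 0 \<le> inner (x - y) (V x - V y))"

text \<open>Weak convergence in an inner product space, tested against the functionals
  \<open>inner _ y\<close>; in a Hilbert space these are all continuous linear functionals.\<close>

definition weakly_converges_to :: "(nat \<Rightarrow> 'a::real_inner) \<Rightarrow> 'a \<Rightarrow> bool" where
  "weakly_converges_to x l \<longleftrightarrow> (\<forall>y. (\<lambda>n. inner (x n) y) \<longlonglongrightarrow> inner l y)"

text \<open>The recursion starts at \<open>k = 1\<close>, so \<open>z 0\<close>, \<open>z 1\<close> and \<open>zb 0\<close> are
  unconstrained initial points, and \<open>k - 1\<close> never truncates.\<close>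

definition explicit_fast_ogda ::
    "('a::real_inner \<Rightarrow> 'a) \<Rightarrow> real \<Rightarrow> real \<Rightarrow> (nat \<Rightarrow> 'a) \<Rightarrow> (nat \<Rightarrow> 'a) \<Rightarrow> bool" where
  "explicit_fast_ogda V \<alpha> s z zb \<longleftrightarrow>
    (\<forall>k\<ge>1.
      zb k = z k + (1 - \<alpha> / (real k + \<alpha>)) *\<^sub>R (z k - z (k - 1))
               - (\<alpha> * s / (2 * (real k + \<alpha>))) *\<^sub>R V (zb (k - 1)) \<and>
      z (k + 1) = zb k
               - (s / 2 * (1 + real k / (real k + \<alpha>))) *\<^sub>R (V (zb k) - V (zb (k - 1))))"

end

theory Submission
  imports Defs
begin

text \<open>
  Write \<open>d\<^sub>k = z\<^sub>k - z\<^sub>k\<^sub>-\<^sub>1\<close>, \<open>y\<^sub>k = s V(zb\<^sub>k\<^sub>-\<^sub>1)\<close> and \<open>e\<^sub>k = y\<^sub>k - y\<^sub>k\<^sub>-\<^sub>1\<close>.  Eliminating \<open>zb\<close> from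
  the two update rules leaves one recurrence (lemma \<open>recurrence\<close>),
  \<open>(k + \<alpha>) d\<^sub>k\<^sub>+\<^sub>1 = k d\<^sub>k - \<alpha>/2 y\<^sub>k\<^sub>+\<^sub>1 - k e\<^sub>k\<^sub>+\<^sub>1\<close>, an implicit discretisation of
  \<open>x'' + \<alpha>/t x' + \<alpha>/(2t) V(x) + (d/dt) V(x) = 0\<close>, except that \<open>y\<^sub>k\<close> samples \<open>V\<close> at the
  extrapolated point and not at \<open>z\<^sub>k\<close> (in the equation \<open>V\<close> stands for
  \<open>s V\<close>).  The defect \<open>r\<^sub>k = s V(z\<^sub>k) - y\<^sub>k\<close> satisfies \<open>|r\<^sub>k| \<le> s L |e\<^sub>k|\<close> with \<open>s L < 1/2\<close>.

  For a zero \<open>w\<close> of \<open>V\<close> and a weight \<open>\<lambda>\<close> the flow has the Lyapunov function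
  \<open>1/2 |\<lambda>(x - w) + t x' + t/2 V|^2 + 1/2 \<lambda>(\<alpha> - 1 - \<lambda>)|x - w|^2 + 1/2 \<lambda>t\<langle>x - w, V\<rangle> + 1/8 t^2 |V|^2\<close>,
  whose derivative is, up to the favourable term in \<open>\<langle>x', (d/dt) V\<rangle> \<ge> 0\<close>, a negative multiple
  of \<open>\<langle>x - w, V\<rangle>\<close> plus \<open>t\<close> times a quadratic form in \<open>x'\<close> and \<open>V\<close> that is negative definite
  exactly when \<open>1 < \<lambda> < \<alpha> - 1\<close>.  This interval is nonempty because \<open>\<alpha> > 2\<close>.  The discrete
  \<open>energy\<close> adds two terms.  Monotonicity controls \<open>\<langle>d\<^sub>k\<^sub>+\<^sub>1, e\<^sub>k\<^sub>+\<^sub>1 + r\<^sub>k\<^sub>+\<^sub>1 - r\<^sub>k\<rangle>\<close> and not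
  \<open>\<langle>d\<^sub>k\<^sub>+\<^sub>1, e\<^sub>k\<^sub>+\<^sub>1\<rangle>\<close>; the term \<open>- 1/2 k^2 \<langle>d\<^sub>k, r\<^sub>k\<rangle>\<close> telescopes the difference down to
  \<open>1/2 k^2 \<langle>e\<^sub>k\<^sub>+\<^sub>1, r\<^sub>k\<rangle>\<close> and terms of lower order, and \<open>1/8 k^2 |e\<^sub>k|^2\<close> makes room
  for that product: convexity of the squares provides \<open>- 1/4 k^2 |e\<^sub>k\<^sub>+\<^sub>1|^2\<close>, which
  beats it because \<open>s L < 1/2\<close>.  The energy remains nonnegative (\<open>energy_lower_bound\<close>) and decreases from some index on (\<open>energy_descent\<close>).

  Hence it converges, \<open>k d\<^sub>k\<close> and \<open>k y\<^sub>k\<close> are bounded, so \<open>V(z\<^sub>k) \<longlonglongrightarrow> 0\<close>, and the series of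
  \<open>\<langle>z\<^sub>k - w, y\<^sub>k\<rangle>\<close> converges.  The energy is affine in \<open>\<lambda>\<close>, so comparing two weights shows that
  \<open>(\<alpha> - 1)/2 |z\<^sub>k - w|^2 + k \<langle>z\<^sub>k - w, d\<^sub>k + y\<^sub>k\<rangle>\<close> converges as well.  That is a first order
  difference expression in \<open>1/2 |z\<^sub>k - w|^2\<close> plus the partial sums of the series, and
  \<open>averaging_limit\<close> turns its convergence into convergence of \<open>|z\<^sub>k - w|\<close>.  Opial's argument
  (\<open>opial_monotone\<close>) then yields the weak limit.
\<close>

section \<open>Weak convergence to a zero of a monotone operator\<close>

text \<open>
  The substitute for weak sequential compactness: a point that lies in every closed half-space
  containing a tail of the sequence.  The intersections \<open>C n\<close> of the half-spaces that contain the
  \<open>n\<close>-th tail (the closed convex hulls of the tails) are nested and meet a common ball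
  around the origin; nearly minimal elements of \<open>C n\<close> form a Cauchy sequence by the parallelogram
  law, and their limit lies in every \<open>C n\<close>.
\<close>

lemma weak_cluster_point:
  fixes x :: "nat \<Rightarrow> 'a::{real_inner, complete_space}"
  assumes "bounded (range x)"
  shows "\<exists>w. \<forall>y c. (\<forall>\<^sub>F k in sequentially. c \<le> x k \<bullet> y) \<longrightarrow> c \<le> w \<bullet> y"
proof -
  define C where "C n = {v. \<forall>y c. (\<forall>k\<ge>n. c \<le> x k \<bullet> y) \<longrightarrow> c \<le> v \<bullet> y}" for n
  define m where "m n = Inf ((\<lambda>v. (norm v)\<^sup>2) ` C n)" for n
  obtain B where B: "\<And>k. norm (x k) \<le> B" using assms by (auto simp: bounded_iff)
  have x_in: "x k \<in> C n" if "n \<le> k" for n k using that by (auto simp: C_def)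
  have C_mono: "C k \<subseteq> C n" if "n \<le> k" for n k
    using that unfolding C_def by (auto intro: le_trans)
  have C_ne: "C n \<noteq> {}" for n using x_in[of n n] by auto
  have bdd: "bdd_below ((\<lambda>v. (norm v)\<^sup>2) ` C n)" for n by (rule bdd_belowI2[of _ 0]) simp
  have m_le: "m n \<le> (norm v)\<^sup>2" if "v \<in> C n" for n v
    unfolding m_def using that bdd by (intro cINF_lower) auto
  have m_mono: "incseq m"
    unfolding m_def incseq_def using C_mono C_ne bdd
    by (intro allI impI cINF_superset_mono) simp_all
  have "m n \<le> B\<^sup>2" for n
    using m_le[OF x_in[of n n]] B[of n] by (meson norm_ge_zero order.trans order_refl power_mono)
  then obtain l where l: "m \<longlonglongrightarrow> l" using incseq_convergent[OF m_mono] by blast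
  have "\<exists>v\<in>C n. (norm v)\<^sup>2 < m n + inverse (real (Suc n))" for n
  proof -
    have "Inf ((\<lambda>v. (norm v)\<^sup>2) ` C n) < m n + inverse (real (Suc n))" by (simp add: m_def)
    thus ?thesis using x_in[of n n] cInf_less_iff[OF _ bdd[of n]] by blast
  qed
  then obtain v where v: "\<And>n. v n \<in> C n" "\<And>n. (norm (v n))\<^sup>2 < m n + inverse (real (Suc n))" by metis
  define g where "g n = m n + inverse (real (Suc n))" for n
  have g: "g \<longlonglongrightarrow> l" unfolding g_def using tendsto_add[OF l LIMSEQ_inverse_real_of_nat] by simp
  have near: "(norm (v i - v j))\<^sup>2 \<le> 2 * (g i - m i) + 2 * (g j - m i)" if "i \<le> j" for i j
  proof -
    have "(1/2) *\<^sub>R (v i + v j) \<in> C i"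
    proof -
      have "v i \<in> C i" "v j \<in> C i" using v(1) C_mono[OF that] by auto
      thus ?thesis unfolding C_def by (fastforce simp: inner_simps)
    qed
    hence "m i \<le> (norm ((1/2) *\<^sub>R (v i + v j)))\<^sup>2" by (rule m_le)
    moreover have "(norm (v i - v j))\<^sup>2 = 2 * (norm (v i))\<^sup>2 + 2 * (norm (v j))\<^sup>2
        - 4 * (norm ((1/2) *\<^sub>R (v i + v j)))\<^sup>2"
      unfolding power2_norm_eq_inner by (simp add: inner_simps inner_commute add_divide_distrib)
    ultimately show ?thesis using v(2)[of i] v(2)[of j] by (simp add: g_def)
  qed
  have "Cauchy v"
  proof (rule metric_CauchyI)
    fix \<epsilon> :: real assume "\<epsilon> > 0"
    define \<eta> where "\<eta> = \<epsilon>\<^sup>2 / 8"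
    have "\<eta> > 0" using \<open>\<epsilon> > 0\<close> by (simp add: \<eta>_def)
    have "\<forall>\<^sub>F n in sequentially. \<bar>g n - l\<bar> < \<eta> \<and> \<bar>m n - l\<bar> < \<eta>"
      using tendstoD[OF g \<open>\<eta> > 0\<close>] tendstoD[OF l \<open>\<eta> > 0\<close>] by eventually_elim (auto simp: dist_real_def)
    then obtain N where N: "\<And>n. n \<ge> N \<Longrightarrow> \<bar>g n - l\<bar> < \<eta> \<and> \<bar>m n - l\<bar> < \<eta>"
      by (auto simp: eventually_sequentially)
    have *: "dist (v i) (v j) < \<epsilon>" if "N \<le> i" "i \<le> j" for i j
    proof -
      have "(norm (v i - v j))\<^sup>2 < \<epsilon>\<^sup>2"
      proof -
        have "g i < l + \<eta>" "l - \<eta> < m i" using N[OF that(1)] by auto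
        moreover have "g j < l + \<eta>" using N[of j] that by auto
        moreover have "\<epsilon>\<^sup>2 = 8 * \<eta>" by (simp add: \<eta>_def)
        ultimately have "2 * (g i - m i) + 2 * (g j - m i) < \<epsilon>\<^sup>2" by simp
        with near[OF that(2)] show ?thesis by (rule le_less_trans)
      qed
      thus ?thesis using \<open>\<epsilon> > 0\<close> by (simp add: dist_norm power2_less_imp_less)
    qed
    show "\<exists>M. \<forall>m\<ge>M. \<forall>n\<ge>M. dist (v m) (v n) < \<epsilon>"
      using * by (metis dist_commute nle_le)
  qed
  then obtain w where w: "v \<longlonglongrightarrow> w" using Cauchy_convergent convergent_def by blast
  have "c \<le> w \<bullet> y" if ev: "\<forall>\<^sub>F k in sequentially. c \<le> x k \<bullet> y" for y c
  proof -
    obtain N where N: "\<And>k. k \<ge> N \<Longrightarrow> c \<le> x k \<bullet> y" using ev by (auto simp: eventually_sequentially)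
    have "c \<le> v k \<bullet> y" if "k \<ge> N" for k
      using v(1)[of k] N that unfolding C_def by auto
    moreover have "(\<lambda>k. v k \<bullet> y) \<longlonglongrightarrow> w \<bullet> y" using w by (intro tendsto_intros)
    ultimately show ?thesis by (intro Lim_bounded2) auto
  qed
  thus ?thesis by blast
qed

text \<open>
  Minty's trick: test the inequality at \<open>u = w - h V(w)\<close>, divide by \<open>h\<close> and let \<open>h\<close> tend to 0.
\<close>

lemma minty:
  fixes V :: "'a::real_inner \<Rightarrow> 'a"
  assumes cont: "continuous_on UNIV V" and *: "\<And>u. 0 \<le> (u - w) \<bullet> V u"
  shows "V w = 0"
proof -
  have "(\<lambda>n. w - inverse (real (Suc n)) *\<^sub>R V w) \<longlonglongrightarrow> w - 0 *\<^sub>R V w"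
    by (intro tendsto_intros LIMSEQ_inverse_real_of_nat)
  hence "(\<lambda>n. V (w - inverse (real (Suc n)) *\<^sub>R V w)) \<longlonglongrightarrow> V w"
    using cont by (intro continuous_on_tendsto_compose[OF cont]) auto
  hence "(\<lambda>n. V w \<bullet> V (w - inverse (real (Suc n)) *\<^sub>R V w)) \<longlonglongrightarrow> V w \<bullet> V w"
    by (intro tendsto_intros)
  moreover have "V w \<bullet> V (w - inverse (real (Suc n)) *\<^sub>R V w) \<le> 0" for n
  proof -
    have "0 \<le> - inverse (real (Suc n)) * (V w \<bullet> V (w - inverse (real (Suc n)) *\<^sub>R V w))"
      using *[of "w - inverse (real (Suc n)) *\<^sub>R V w"] by (simp add: inner_diff_left)
    thus ?thesis by (simp add: mult_le_0_iff zero_le_mult_iff)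
  qed
  ultimately have "V w \<bullet> V w \<le> 0" by (intro Lim_bounded) auto
  thus ?thesis by (metis inner_eq_zero_iff inner_ge_zero order_antisym)
qed

text \<open>
  For two zeros \<open>a\<close> and \<open>b\<close>, the inner product \<open>\<langle>x\<^sub>k, a - b\<rangle>\<close> is a difference of squared distances
  up to a constant, so it converges.  Every subsequence has a cluster point in the sense of
  \<open>weak_cluster_point\<close>, and by Minty's trick that point is a zero.  If \<open>a\<close> and \<open>b\<close> are two such
  cluster points, then \<open>\<langle>a, a - b\<rangle>\<close> and \<open>\<langle>b, a - b\<rangle>\<close> both equal the limit of \<open>\<langle>x\<^sub>k, a - b\<rangle>\<close>, so
  \<open>a = b\<close>.  A subsequence that stayed away from the common cluster point in some direction would
  have a different one.
\<close>

lemma opial_monotone: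
  fixes V :: "'a::{real_inner, complete_space} \<Rightarrow> 'a"
  assumes mono: "monotone_operator V" and cont: "continuous_on UNIV V"
    and ne: "\<exists>w. V w = 0"
    and dist: "\<And>w. V w = 0 \<Longrightarrow> convergent (\<lambda>k. (norm (x k - w))\<^sup>2)"
    and res: "(\<lambda>k. V (x k)) \<longlonglongrightarrow> 0"
  shows "\<exists>w. V w = 0 \<and> weakly_converges_to x w"
proof -
  obtain p where p: "V p = 0" using ne by blast
  have bdd: "bounded (range x)"
  proof -
    have "bounded (range (\<lambda>k. (norm (x k - p))\<^sup>2))"
      by (rule convergent_imp_bounded[OF dist[OF p, unfolded convergent_LIMSEQ_iff]])
    then obtain B where B: "\<And>k. (norm (x k - p))\<^sup>2 \<le> B" by (auto simp: bounded_iff)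
    have "norm (x k) \<le> sqrt B + norm p" for k
      using real_le_rsqrt[OF B[of k]] norm_triangle_sub[of "x k" p] by linarith
    thus ?thesis by (auto simp: bounded_iff)
  qed
  have cluster: "\<exists>w. V w = 0 \<and> (\<forall>y c. (\<forall>\<^sub>F k in sequentially. c \<le> x (\<sigma> k) \<bullet> y) \<longrightarrow> c \<le> w \<bullet> y)"
    if \<sigma>: "strict_mono \<sigma>" for \<sigma> :: "nat \<Rightarrow> nat"
  proof -
    have "bounded (range (\<lambda>k. x (\<sigma> k)))" using bdd by (rule bounded_subset) auto
    from weak_cluster_point[OF this] obtain w
      where w: "\<And>y c. \<forall>\<^sub>F k in sequentially. c \<le> x (\<sigma> k) \<bullet> y \<Longrightarrow> c \<le> w \<bullet> y" by blast
    have "0 \<le> (u - w) \<bullet> V u" for u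
    proof (rule field_le_epsilon)
      fix \<epsilon> :: real assume "\<epsilon> > 0"
      obtain B where B: "\<And>k. norm (x k) \<le> B" using bdd by (auto simp: bounded_iff)
      have bd: "norm (u - x k) \<le> norm u + B" for k using B[of k] norm_triangle_ineq4[of u "x k"] by linarith
      have "(\<lambda>k. (norm u + B) * norm (V (x k))) \<longlonglongrightarrow> (norm u + B) * norm (0::'a)"
        using res by (intro tendsto_intros)
      hence "\<forall>\<^sub>F k in sequentially. (norm u + B) * norm (V (x k)) < \<epsilon>"
        using \<open>\<epsilon> > 0\<close> by (intro order_tendstoD(2)) auto
      hence "\<forall>\<^sub>F k in sequentially. (norm u + B) * norm (V (x (\<sigma> k))) < \<epsilon>"
        by (rule eventually_subseq[OF \<sigma>])
      hence "\<forall>\<^sub>F k in sequentially. - (u \<bullet> V u) - \<epsilon> \<le> x (\<sigma> k) \<bullet> (- V u)"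
      proof eventually_elim
        case (elim k)
        have "0 \<le> (u - x (\<sigma> k)) \<bullet> (V u - V (x (\<sigma> k)))"
          using mono by (simp add: monotone_operator_def)
        moreover have "- ((u - x (\<sigma> k)) \<bullet> V (x (\<sigma> k))) \<le> (norm u + B) * norm (V (x (\<sigma> k)))"
          using Cauchy_Schwarz_ineq2[of "u - x (\<sigma> k)" "V (x (\<sigma> k))"]
            mult_right_mono[OF bd[of "\<sigma> k"] norm_ge_zero[of "V (x (\<sigma> k))"]] by linarith
        ultimately show ?case using elim by (simp add: inner_diff_left inner_diff_right)
      qed
      from w[OF this] show "0 \<le> (u - w) \<bullet> V u + \<epsilon>" by (simp add: inner_diff_left)
    qed
    hence "V w = 0" by (rule minty[OF cont])
    thus ?thesis using w by blast
  qed
  have limit: "w \<bullet> (a - b) = l"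
    if \<sigma>: "strict_mono \<sigma>" and l: "(\<lambda>k. x k \<bullet> (a - b)) \<longlonglongrightarrow> l"
      and w: "\<And>y c. \<forall>\<^sub>F k in sequentially. c \<le> x (\<sigma> k) \<bullet> y \<Longrightarrow> c \<le> w \<bullet> y"
    for \<sigma> :: "nat \<Rightarrow> nat" and w a b l
  proof (rule antisym; rule field_le_epsilon)
    fix \<epsilon> :: real assume "\<epsilon> > 0"
    have "\<forall>\<^sub>F k in sequentially. l - \<epsilon> \<le> x k \<bullet> (a - b) \<and> - (l + \<epsilon>) \<le> x k \<bullet> (- (a - b))"
      using tendstoD[OF l \<open>\<epsilon> > 0\<close>] by eventually_elim (auto simp: dist_real_def inner_diff_right)
    from eventually_subseq[OF \<sigma> this]
    have ev: "\<forall>\<^sub>F k in sequentially. l - \<epsilon> \<le> x (\<sigma> k) \<bullet> (a - b)"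
      "\<forall>\<^sub>F k in sequentially. - (l + \<epsilon>) \<le> x (\<sigma> k) \<bullet> (- (a - b))"
      by (auto elim: eventually_mono)
    show "w \<bullet> (a - b) \<le> l + \<epsilon>" using w[OF ev(2)] unfolding inner_minus_right by linarith
    show "l \<le> w \<bullet> (a - b) + \<epsilon>" using w[OF ev(1)] by linarith
  qed
  have ident: "convergent (\<lambda>k. x k \<bullet> (a - b))" if ab: "V a = 0" "V b = 0" for a b
  proof -
    have *: "x k \<bullet> (a - b) = (norm (x k - b))\<^sup>2 / 2 - (norm (x k - a))\<^sup>2 / 2 + ((norm a)\<^sup>2 - (norm b)\<^sup>2) / 2" for k
      unfolding power2_norm_eq_inner by (simp add: inner_simps inner_commute field_simps)
    obtain la lb where "(\<lambda>k. (norm (x k - a))\<^sup>2) \<longlonglongrightarrow> la" "(\<lambda>k. (norm (x k - b))\<^sup>2) \<longlonglongrightarrow> lb"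
      using dist[OF ab(1)] dist[OF ab(2)] by (auto simp: convergent_def)
    hence "(\<lambda>k. x k \<bullet> (a - b)) \<longlonglongrightarrow> lb / 2 - la / 2 + ((norm a)\<^sup>2 - (norm b)\<^sup>2) / 2"
      unfolding * by (intro tendsto_intros) auto
    thus ?thesis by (auto simp: convergent_def)
  qed
  have unique: "a = b"
    if "strict_mono \<sigma>" "V a = 0" "\<And>y c. \<forall>\<^sub>F k in sequentially. c \<le> x (\<sigma> k) \<bullet> y \<Longrightarrow> c \<le> a \<bullet> y"
      and "strict_mono \<tau>" "V b = 0" "\<And>y c. \<forall>\<^sub>F k in sequentially. c \<le> x (\<tau> k) \<bullet> y \<Longrightarrow> c \<le> b \<bullet> y"
    for \<sigma> \<tau> :: "nat \<Rightarrow> nat" and a b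
  proof -
    obtain l where l: "(\<lambda>k. x k \<bullet> (a - b)) \<longlonglongrightarrow> l"
      using ident[OF \<open>V a = 0\<close> \<open>V b = 0\<close>] by (auto simp: convergent_def)
    have "a \<bullet> (a - b) = b \<bullet> (a - b)"
      using limit[OF that(1) l that(3)] limit[OF that(4) l that(6)] by simp
    hence "(a - b) \<bullet> (a - b) = 0" by (simp add: inner_diff_left)
    thus ?thesis by simp
  qed
  obtain w where w: "V w = 0" "\<And>y c. \<forall>\<^sub>F k in sequentially. c \<le> x k \<bullet> y \<Longrightarrow> c \<le> w \<bullet> y"
    using cluster[OF strict_mono_id] by auto
  have lower: "\<forall>\<^sub>F k in sequentially. w \<bullet> y - \<epsilon> < x k \<bullet> y" if "\<epsilon> > 0" for y and \<epsilon> :: real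
  proof (rule ccontr)
    assume "\<not> ?thesis"
    hence "\<exists>\<^sub>F k in sequentially. x k \<bullet> y \<le> w \<bullet> y - \<epsilon>"
      by (simp add: not_eventually not_less)
    hence "infinite {k. x k \<bullet> y \<le> w \<bullet> y - \<epsilon>}"
      by (simp add: cofinite_eq_sequentially[symmetric] frequently_cofinite)
    then obtain \<sigma> :: "nat \<Rightarrow> nat"
      where \<sigma>: "strict_mono \<sigma>" "\<And>k. x (\<sigma> k) \<bullet> y \<le> w \<bullet> y - \<epsilon>"
      using infinite_enumerate by blast
    obtain v where v: "V v = 0" "\<And>y c. \<forall>\<^sub>F k in sequentially. c \<le> x (\<sigma> k) \<bullet> y \<Longrightarrow> c \<le> v \<bullet> y"
      using cluster[OF \<sigma>(1)] by blast
    have "v = w" by (rule unique[OF \<sigma>(1) v strict_mono_id w(1)]) (use w(2) in auto)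
    moreover have "- (w \<bullet> y - \<epsilon>) \<le> x (\<sigma> k) \<bullet> (- y)" for k using \<sigma>(2)[of k] by simp
    hence "- (w \<bullet> y - \<epsilon>) \<le> v \<bullet> (- y)" by (intro v(2) always_eventually) blast
    ultimately show False using that by simp
  qed
  have "weakly_converges_to x w"
    unfolding weakly_converges_to_def
  proof (intro allI tendstoI)
    fix y and \<epsilon> :: real assume "\<epsilon> > 0"
    from lower[OF this, of y] lower[OF this, of "- y"]
    show "\<forall>\<^sub>F k in sequentially. dist (x k \<bullet> y) (w \<bullet> y) < \<epsilon>"
      by eventually_elim (auto simp: dist_real_def)
  qed
  thus ?thesis using w(1) by blast
qed


section \<open>Limits of real sequences\<close>

text \<open>
  The discrete counterpart of: if \<open>b q(t) + t q'(t)\<close> converges to \<open>l\<close>, then \<open>q(t)\<close> converges to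
  \<open>l / b\<close>.  With \<open>p = |q - l/b|\<close> the hypothesis and \<open>b \<ge> 1\<close> let \<open>(k + 1) p\<^sub>k\<close> grow by at
  most the terms of a null sequence, so \<open>p\<close> is dominated by the arithmetic means of a null sequence.
\<close>

lemma averaging_limit:
  fixes q :: "nat \<Rightarrow> real"
  assumes b: "1 \<le> b"
    and lim: "(\<lambda>k. b * q (Suc k) + real (Suc k) * (q (Suc k) - q k)) \<longlonglongrightarrow> l"
  shows "q \<longlonglongrightarrow> l / b"
proof -
  define p where "p k = \<bar>q k - l / b\<bar>" for k
  define m where "m k = \<bar>b * q (Suc k) + real (Suc k) * (q (Suc k) - q k) - l\<bar>" for k
  have m: "m \<longlonglongrightarrow> 0"
    unfolding m_def by (rule tendsto_rabs_zero) (use lim in \<open>simp add: LIM_zero_iff\<close>)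
  have step: "real (Suc k + 1) * p (Suc k) \<le> real (k + 1) * p k + m k" for k
  proof -
    have "(real (Suc k) + b) * (q (Suc k) - l / b) = real (Suc k) * (q k - l / b)
        + (b * q (Suc k) + real (Suc k) * (q (Suc k) - q k) - l)"
      using b by (simp add: field_simps)
    hence "\<bar>(real (Suc k) + b) * (q (Suc k) - l / b)\<bar> \<le> \<bar>real (Suc k) * (q k - l / b)\<bar> + m k"
      unfolding m_def by (metis abs_triangle_ineq)
    hence "(real (Suc k) + b) * p (Suc k) \<le> real (Suc k) * p k + m k"
      using b by (simp add: p_def abs_mult)
    moreover have "real (Suc k + 1) * p (Suc k) \<le> (real (Suc k) + b) * p (Suc k)"
      using b by (intro mult_right_mono) (auto simp: p_def)
    ultimately show ?thesis by simp
  qed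
  have "p \<longlonglongrightarrow> 0"
  proof (rule LIMSEQ_I)
    fix \<epsilon> :: real assume "\<epsilon> > 0"
    obtain N where N: "\<And>k. k \<ge> N \<Longrightarrow> m k < \<epsilon> / 2"
      using order_tendstoD(2)[OF m, of "\<epsilon> / 2"] \<open>\<epsilon> > 0\<close> by (auto simp: eventually_sequentially)
    define A where "A = real (N + 1) * p N"
    have bound: "real (k + 1) * p k \<le> A + \<epsilon> / 2 * real k" if "k \<ge> N" for k
      using that
    proof (induction k rule: dec_induct)
      case base show ?case using \<open>\<epsilon> > 0\<close> by (simp add: A_def)
    next
      case (step k)
      thus ?case using \<open>\<And>k. real (Suc k + 1) * p (Suc k) \<le> _\<close>[of k] N[of k] by (simp add: algebra_simps add_divide_distrib)
    qed
    obtain K where K: "A < \<epsilon> / 2 * real K" using \<open>\<epsilon> > 0\<close> reals_Archimedean3[of "\<epsilon> / 2"] by (metis half_gt_zero mult.commute)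
    have "norm (p k - 0) < \<epsilon>" if "k \<ge> max N K" for k
    proof -
      have "\<epsilon> / 2 * real K \<le> \<epsilon> / 2 * real k" using that \<open>\<epsilon> > 0\<close> by simp
      moreover have "\<epsilon> * real k \<le> real (k + 1) * \<epsilon>" using \<open>\<epsilon> > 0\<close> by (simp add: algebra_simps)
      ultimately have "real (k + 1) * p k < real (k + 1) * \<epsilon>"
        using bound[of k] K that by linarith
      moreover have "p k \<ge> 0" by (simp add: p_def)
      ultimately show ?thesis by (simp add: mult_less_cancel_left_pos del: of_nat_Suc of_nat_add)
    qed
    thus "\<exists>no. \<forall>n\<ge>no. norm (p n - 0) < \<epsilon>" by blast
  qed
  hence "(\<lambda>k. q k - l / b) \<longlonglongrightarrow> 0" unfolding p_def by (simp add: tendsto_rabs_zero_iff)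
  thus ?thesis by (simp add: LIM_zero_iff)
qed

lemma lyapunov_convergence:
  fixes E G :: "nat \<Rightarrow> real"
  assumes E: "\<forall>\<^sub>F k in sequentially. 0 \<le> E k" and G: "\<forall>\<^sub>F k in sequentially. 0 \<le> G k"
    and desc: "\<forall>\<^sub>F k in sequentially. E (Suc k) \<le> E k - G k"
  shows "convergent E" "summable G"
proof -
  obtain N where N: "\<And>k. k \<ge> N \<Longrightarrow> 0 \<le> E k \<and> 0 \<le> G k \<and> E (Suc k) \<le> E k - G k"
    using eventually_conj[OF E eventually_conj[OF G desc]] by (auto simp: eventually_sequentially)
  have dec: "decseq (\<lambda>k. E (k + N))"
  proof (rule decseq_SucI)
    fix k show "E (Suc k + N) \<le> E (k + N)" using N[of "k + N"] by simp
  qed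
  have "\<forall>k. 0 \<le> E (k + N)" using N by simp
  from decseq_convergent[OF dec this] obtain l where "(\<lambda>k. E (k + N)) \<longlonglongrightarrow> l" by auto
  hence l: "E \<longlonglongrightarrow> l" using LIMSEQ_offset by blast
  thus "convergent E" by (auto simp: convergent_def)
  show "summable G"
  proof (rule summable_comparison_test_ev)
    show "summable (\<lambda>k. E k - E (Suc k))" by (rule telescope_summable'[OF l])
    show "\<forall>\<^sub>F k in sequentially. norm (G k) \<le> E k - E (Suc k)"
      unfolding eventually_sequentially using N by (intro exI[of _ N]) force
  qed
qed

lemma tendsto_zero_of_scaled_bound:
  fixes u :: "nat \<Rightarrow> 'a::real_normed_vector"
  assumes "\<And>k. k \<ge> 2 \<Longrightarrow> norm (real k *\<^sub>R u k) \<le> B"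
  shows "u \<longlonglongrightarrow> 0"
proof (rule Lim_null_comparison)
  show "\<forall>\<^sub>F k in sequentially. norm (u k) \<le> B / real k"
    using eventually_ge_at_top[of 2]
  proof eventually_elim
    case (elim k)
    thus ?case using assms[OF elim] by (simp add: pos_le_divide_eq mult.commute)
  qed
  show "(\<lambda>k. B / real k) \<longlonglongrightarrow> 0" by (rule lim_const_over_n)
qed

section \<open>The energy and its descent\<close>

text \<open>
  In the application \<open>t = k\<close>, \<open>x = z\<^sub>k - w\<close>, \<open>d\<close> is the last displacement, \<open>y\<close> the scaled operator
  value at the last extrapolated point, \<open>e\<close> its last increment and \<open>r\<close> the defect
  \<open>s V(z\<^sub>k) - y\<close>.
\<close>

definition energy :: "real \<Rightarrow> real \<Rightarrow> real \<Rightarrow> 'a::real_inner \<Rightarrow> 'a \<Rightarrow> 'a \<Rightarrow> 'a \<Rightarrow> 'a \<Rightarrow> real" where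
  "energy \<alpha> lam t x d y e r =
     (norm (lam *\<^sub>R x + t *\<^sub>R d + (t / 2) *\<^sub>R y))\<^sup>2 / 2
     + lam * (\<alpha> - 1 - lam) / 2 * (norm x)\<^sup>2 + lam * t / 2 * (x \<bullet> y)
     + t * (t + 1) / 8 * (norm y)\<^sup>2
     - t\<^sup>2 / 2 * (d \<bullet> r) + t\<^sup>2 / 8 * (norm e)\<^sup>2"

text \<open>
  The indefinite term \<open>- 1/2 t^2 \<langle>d, r\<rangle>\<close> is in general too large for the definite ones.  With
  \<open>X = \<lambda>x + t d\<close> it is \<open>- t/2 \<langle>X, r\<rangle> + \<lambda>t/2 \<langle>x, r\<rangle>\<close>; the second part combines with
  \<open>\<lambda>t/2 \<langle>x, y\<rangle>\<close> to the monotonicity product \<open>\<langle>x, y + r\<rangle> \<ge> 0\<close>, and only the first part needs the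
  Cauchy-Schwarz inequality.
\<close>

lemma energy_lower_bound:
  fixes x d y e r :: "'a::real_inner"
  assumes "0 \<le> lam" "0 \<le> t" and r: "norm r \<le> norm e / 2" and xy: "0 \<le> x \<bullet> (y + r)"
  shows "(norm (lam *\<^sub>R x + t *\<^sub>R d))\<^sup>2 / 8 + (norm (lam *\<^sub>R x + t *\<^sub>R d + t *\<^sub>R y))\<^sup>2 / 4
           + lam * (\<alpha> - 1 - lam) / 2 * (norm x)\<^sup>2 \<le> energy \<alpha> lam t x d y e r"
proof -
  define X where "X = lam *\<^sub>R x + t *\<^sub>R d"
  have split: "energy \<alpha> lam t x d y e r = (norm X)\<^sup>2 / 4 + (norm (X + t *\<^sub>R y))\<^sup>2 / 4
      + lam * (\<alpha> - 1 - lam) / 2 * (norm x)\<^sup>2 + lam * t / 2 * (x \<bullet> (y + r)) + t / 8 * (norm y)\<^sup>2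
      - t / 2 * (X \<bullet> r) + t\<^sup>2 / 8 * (norm e)\<^sup>2"
    unfolding energy_def X_def power2_norm_eq_inner
    by (simp add: inner_simps inner_commute field_simps power2_eq_square)
  have "t / 2 * (X \<bullet> r) \<le> t / 2 * (norm X * (norm e / 2))"
    using norm_cauchy_schwarz[of X r] mult_left_mono[OF r norm_ge_zero[of X]] \<open>0 \<le> t\<close>
    by (intro mult_left_mono) auto
  also have "\<dots> \<le> (norm X)\<^sup>2 / 8 + t\<^sup>2 / 8 * (norm e)\<^sup>2"
    using sum_squares_bound[of "norm X" "t * norm e"] by (simp add: power_mult_distrib mult_ac)
  finally have young: "t / 2 * (X \<bullet> r) \<le> (norm X)\<^sup>2 / 8 + t\<^sup>2 / 8 * (norm e)\<^sup>2" .
  show ?thesis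
  proof -
    have "0 \<le> lam * t / 2 * (x \<bullet> (y + r))" "0 \<le> t / 8 * (norm y)\<^sup>2"
      using assms by (simp_all del: inner_add_right)
    with young show ?thesis
      unfolding split X_def[symmetric] by linarith
  qed
qed

text \<open>
  Varying the weight isolates a quantity from which \<open>e\<close>, \<open>r\<close> and the squared norms of \<open>d\<close> and \<open>y\<close>
  have disappeared.
\<close>

lemma energy_affine:
  "energy \<alpha> lam t x d y e r - energy \<alpha> mu t x d y e r
     = (lam - mu) * ((\<alpha> - 1) * ((norm x)\<^sup>2 / 2) + t * (x \<bullet> (d + y)))"
proof -
  have split: "energy \<alpha> l t x d y e r = l * ((\<alpha> - 1) * ((norm x)\<^sup>2 / 2) + t * (x \<bullet> (d + y)))
      + energy \<alpha> 0 t x d y e r" for l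
    unfolding energy_def power2_norm_eq_inner
    by (simp add: inner_simps inner_commute algebra_simps power2_eq_square add_divide_distrib diff_divide_distrib)
  show ?thesis unfolding split[of lam] split[of mu] by (simp add: left_diff_distrib)
qed

text \<open>
  The exact change of the energy in one step: \<open>d\<close>, \<open>y\<close>, \<open>e\<close>, \<open>r'\<close> belong to the new index and \<open>dk\<close>,
  \<open>y - e\<close>, \<open>f\<close>, \<open>r\<close> to the old one.  The negative square of
  \<open>(\<alpha> - 1 - \<lambda>) d + (\<alpha> - 1)/2 y + t/2 e\<close> is the convexity gain: that vector is minus the increment
  of the vector inside the first square of the energy.
\<close>

lemma energy_difference:
  fixes x d y e f r r' dk :: "'a::real_inner"
  assumes rec: "t *\<^sub>R dk = (t + \<alpha>) *\<^sub>R d + (\<alpha> / 2) *\<^sub>R y + t *\<^sub>R e"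
  shows "energy \<alpha> lam (t + 1) x d y e r' - energy \<alpha> lam t (x - d) dk (y - e) f r =
     - (lam * (\<alpha> - 2) / 2) * (x \<bullet> y)
     - (t + 1) * ((\<alpha> - 1 - lam) * (norm (d + (1/2) *\<^sub>R y))\<^sup>2 + (lam - 1) / 4 * (norm y)\<^sup>2)
     - (\<alpha> - 1 - lam) * lam / 2 * (norm d)\<^sup>2 - lam / 2 * (d \<bullet> y)
     - t * (t + lam + 1) / 2 * (d \<bullet> e) + (t + 1) / 8 * (norm e)\<^sup>2
     - (norm ((\<alpha> - 1 - lam) *\<^sub>R d + ((\<alpha> - 1) / 2) *\<^sub>R y + (t / 2) *\<^sub>R e))\<^sup>2 / 2
     - (t + 1)\<^sup>2 / 2 * (d \<bullet> r')
     + t / 2 * (((t + \<alpha>) *\<^sub>R d + (\<alpha> / 2) *\<^sub>R y + t *\<^sub>R e) \<bullet> r)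
     - t\<^sup>2 / 8 * (norm f)\<^sup>2"
proof -
  have 1: "t\<^sup>2 / 2 * (dk \<bullet> r) = t / 2 * (((t + \<alpha>) *\<^sub>R d + (\<alpha> / 2) *\<^sub>R y + t *\<^sub>R e) \<bullet> r)"
    unfolding rec[symmetric] by (simp add: power2_eq_square)
  show ?thesis
    unfolding energy_def 1 rec power2_norm_eq_inner
    by (simp add: inner_simps inner_commute field_simps power2_eq_square)
qed

text \<open>
  All products that occur with a factor \<open>t\<close> only are dominated for large \<open>t\<close>: by Young's
  inequality \<open>t (D + Y)(e + f)\<close> is split into a small part of \<open>t (D^2 + Y^2)\<close> and a large multiple
  of \<open>t (e^2 + f^2)\<close>, and the latter is eventually small against \<open>t^2 (e^2 + f^2)\<close>.  At order
  \<open>t^2\<close> the product \<open>\<kappa>/2 e f\<close> is at most \<open>\<kappa>/4 (e^2 + f^2)\<close>, so \<open>\<kappa> < 1/2\<close> leaves a margin.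
\<close>

lemma absorb_cross_terms:
  fixes c lam M \<kappa> :: real
  assumes c: "0 < c" and lam: "0 \<le> lam" and kap: "0 \<le> \<kappa>" "\<kappa> < 1 / 2"
  shows "\<exists>\<delta>>0. \<exists>T\<ge>1. \<forall>t\<ge>T. \<forall>D Y e f.
     M * t * (D + Y) * (e + f) + lam / 2 * (D * Y) + (t + 1) / 8 * e\<^sup>2
       - t\<^sup>2 / 8 * (e\<^sup>2 + f\<^sup>2) + \<kappa> / 2 * t\<^sup>2 * (e * f) - c * (t + 1) * (D\<^sup>2 + Y\<^sup>2)
     \<le> - \<delta> * (t * (D\<^sup>2 + Y\<^sup>2) + t\<^sup>2 * e\<^sup>2)"
proof -
  define \<nu> where "\<nu> = (1 - 2 * \<kappa>) / 8"
  define N where "N = 2 * M\<^sup>2 / c + 1 / 4"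
  \<comment> \<open>from this threshold on, \<open>t\<close> times a constant is absorbed by \<open>t\<^sup>2\<close>\<close>
  define T where "T = Max {1, lam / c, 2 * N / \<nu>}"
  define \<delta> where "\<delta> = min (c / 4) (\<nu> / 2)"
  have nu: "\<nu> > 0" using kap by (simp add: \<nu>_def)
  have "\<delta> > 0" using nu c by (simp add: \<delta>_def)
  moreover have "T \<ge> 1" by (simp add: T_def)
  moreover have "M * t * (D + Y) * (e + f) + lam / 2 * (D * Y) + (t + 1) / 8 * e\<^sup>2
       - t\<^sup>2 / 8 * (e\<^sup>2 + f\<^sup>2) + \<kappa> / 2 * t\<^sup>2 * (e * f) - c * (t + 1) * (D\<^sup>2 + Y\<^sup>2)
     \<le> - \<delta> * (t * (D\<^sup>2 + Y\<^sup>2) + t\<^sup>2 * e\<^sup>2)" if "t \<ge> T" for t D Y e f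
  proof -
    have t: "t \<ge> 1" "t \<ge> lam / c" "t \<ge> 2 * N / \<nu>"
      using that by (auto simp: T_def)
    have tl: "lam \<le> t * c" and tN: "2 * N \<le> t * \<nu>"
      using t c nu by (simp_all add: field_simps)
    have young: "M * (D + Y) * (e + f) \<le> c / 2 * (D\<^sup>2 + Y\<^sup>2) + 2 * M\<^sup>2 / c * (e\<^sup>2 + f\<^sup>2)"
    proof -
      have "M * (D + Y) * (e + f) \<le> c / 4 * (D + Y)\<^sup>2 + M\<^sup>2 / c * (e + f)\<^sup>2"
      proof -
        \<comment> \<open>Young's inequality, multiplied by \<open>c\<close>\<close>
        have complete_square: "c * (M * P * Q) \<le> c * (c / 4 * P\<^sup>2 + M\<^sup>2 / c * Q\<^sup>2)" for P Q
        proof -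
          have "0 \<le> (c / 2 * P - M * Q)\<^sup>2" by simp
          thus ?thesis using c by (simp add: power2_eq_square algebra_simps)
        qed
        from this[of "D + Y" "e + f"] show ?thesis using c mult_le_cancel_left_pos by blast
      qed
      moreover have "(D + Y)\<^sup>2 \<le> 2 * (D\<^sup>2 + Y\<^sup>2)" "(e + f)\<^sup>2 \<le> 2 * (e\<^sup>2 + f\<^sup>2)"
        using sum_squares_bound[of D Y] sum_squares_bound[of e f] by (auto simp: power2_sum)
      ultimately show ?thesis
        using c mult_left_mono[of "(D + Y)\<^sup>2" "2 * (D\<^sup>2 + Y\<^sup>2)" "c / 4"]
          mult_left_mono[of "(e + f)\<^sup>2" "2 * (e\<^sup>2 + f\<^sup>2)" "M\<^sup>2 / c"]
        by (simp add: add_divide_distrib distrib_left mult.assoc)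
    qed
    define S where "S = D\<^sup>2 + Y\<^sup>2"
    define G where "G = e\<^sup>2 + f\<^sup>2"
    have SG: "0 \<le> S" "0 \<le> G" "e\<^sup>2 \<le> G" by (auto simp: S_def G_def)
    have 1: "M * t * (D + Y) * (e + f) \<le> c / 2 * (t * S) + 2 * M\<^sup>2 / c * (t * G)"
      using mult_left_mono[OF young, of t] t unfolding S_def[symmetric] G_def[symmetric] by (simp add: distrib_left mult_ac)
    have 2: "lam / 2 * (D * Y) \<le> c / 4 * (t * S)"
    proof -
      have "lam / 2 * (D * Y) \<le> lam / 4 * S"
        using sum_squares_bound[of D Y] lam mult_left_mono[of "2 * (D * Y)" "D\<^sup>2 + Y\<^sup>2" "lam / 4"]
        by (simp add: algebra_simps S_def)
      also have "\<dots> \<le> (t * c) / 4 * S"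
        using tl SG by (intro mult_right_mono) auto
      finally show ?thesis by (simp add: mult_ac)
    qed
    have 3: "(t + 1) / 8 * e\<^sup>2 \<le> 1 / 4 * (t * G)"
    proof -
      have "(t + 1) / 8 * e\<^sup>2 \<le> t / 4 * G" using t SG by (intro mult_mono) auto
      thus ?thesis by simp
    qed
    have 4: "\<kappa> / 2 * t\<^sup>2 * (e * f) \<le> t\<^sup>2 / 8 * G - \<nu> * (t\<^sup>2 * G)"
    proof -
      have "\<kappa> / 2 * t\<^sup>2 * (e * f) = \<kappa> / 4 * t\<^sup>2 * (2 * e * f)" by simp
      also have "\<dots> \<le> \<kappa> / 4 * t\<^sup>2 * G"
        using sum_squares_bound[of e f] kap unfolding G_def by (intro mult_left_mono) auto
      finally show ?thesis by (simp add: \<nu>_def field_simps)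
    qed
    have 5: "2 * M\<^sup>2 / c * (t * G) + 1 / 4 * (t * G) \<le> \<nu> / 2 * (t\<^sup>2 * G)"
    proof -
      have "(2 * N) / 2 * (t * G) \<le> (t * \<nu>) / 2 * (t * G)" using tN t SG by (intro mult_right_mono) auto
      thus ?thesis by (simp add: power2_eq_square N_def distrib_right distrib_left mult_ac add_divide_distrib)
    qed
    have 6: "\<delta> * (t * S) \<le> c / 4 * (t * S)"
      using t SG by (intro mult_right_mono) (auto simp: \<delta>_def)
    have 7: "\<delta> * (t\<^sup>2 * e\<^sup>2) \<le> \<nu> / 2 * (t\<^sup>2 * G)"
      using t nu SG by (intro mult_mono) (auto simp: \<delta>_def)
    have 8: "c * (t + 1) * S = c * (t * S) + c * S" "0 \<le> c * S"
      using c SG by (simp_all add: algebra_simps)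
    have "M * t * (D + Y) * (e + f) + lam / 2 * (D * Y) + (t + 1) / 8 * e\<^sup>2
       - t\<^sup>2 / 8 * G + \<kappa> / 2 * t\<^sup>2 * (e * f) - c * (t + 1) * S
     \<le> - (\<delta> * (t * S) + \<delta> * (t\<^sup>2 * e\<^sup>2))"
      using 1 2 3 4 5 6 7 8 by linarith
    thus ?thesis by (simp add: S_def G_def distrib_left)
  qed
  ultimately show ?thesis by blast
qed

text \<open>
  With \<open>a = \<alpha> - 1 - \<lambda>\<close> and \<open>b = (\<lambda> - 1)/4\<close> the right-hand side is the leading dissipation in one
  step divided by \<open>t + 1\<close>; both coefficients are positive for admissible weights.
\<close>

lemma quadratic_coercive:
  fixes d y :: "'a::real_inner"
  assumes "m \<le> a" "m \<le> b" "0 \<le> m"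
  shows "m / 2 * ((norm d)\<^sup>2 + (norm y)\<^sup>2) \<le> a * (norm (d + (1/2) *\<^sub>R y))\<^sup>2 + b * (norm y)\<^sup>2"
proof -
  have "(norm (d + (1/2) *\<^sub>R y))\<^sup>2 + (norm y)\<^sup>2
      = 1 / 2 * ((norm d)\<^sup>2 + (norm y)\<^sup>2) + (norm (d + y))\<^sup>2 / 2 + (norm y)\<^sup>2 / 4"
    unfolding power2_norm_eq_inner by (simp add: inner_simps inner_commute field_simps)
  moreover have "0 \<le> (norm (d + y))\<^sup>2 / 2" "0 \<le> (norm y)\<^sup>2 / 4" by simp_all
  ultimately have "1 / 2 * ((norm d)\<^sup>2 + (norm y)\<^sup>2)
      \<le> (norm (d + (1/2) *\<^sub>R y))\<^sup>2 + (norm y)\<^sup>2"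
    by linarith
  hence "m * (1 / 2 * ((norm d)\<^sup>2 + (norm y)\<^sup>2)) \<le> m * ((norm (d + (1/2) *\<^sub>R y))\<^sup>2 + (norm y)\<^sup>2)"
    using assms by (intro mult_left_mono) auto
  also have "\<dots> \<le> a * (norm (d + (1/2) *\<^sub>R y))\<^sup>2 + b * (norm y)\<^sup>2"
    unfolding distrib_left using assms by (intro add_mono mult_right_mono) auto
  finally show ?thesis by simp
qed

text \<open>
  Besides the squares, the decrease contains \<open>\<langle>x, y\<rangle> + |e| |y|\<close>.  Along the algorithm this corrected
  product is nonnegative, whereas \<open>\<langle>x, y\<rangle>\<close> may be negative since \<open>y\<close> is not the operator value at
  \<open>z\<^sub>k\<close>; the correction is a cross term and costs nothing.
\<close>

lemma energy_descent:
  fixes \<alpha> lam \<kappa> :: real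
  assumes lam: "1 < lam" "lam < \<alpha> - 1" and kap: "0 \<le> \<kappa>" "\<kappa> < 1 / 2"
  shows "\<exists>\<delta>>0. \<exists>T. \<forall>t\<ge>T. \<forall>x d dk y e f r r' :: 'a::real_inner.
     t *\<^sub>R dk = (t + \<alpha>) *\<^sub>R d + (\<alpha> / 2) *\<^sub>R y + t *\<^sub>R e \<longrightarrow>
     0 \<le> d \<bullet> (e + r' - r) \<longrightarrow> norm r \<le> \<kappa> * norm f \<longrightarrow> norm r' \<le> \<kappa> * norm e \<longrightarrow>
     energy \<alpha> lam (t + 1) x d y e r' \<le> energy \<alpha> lam t (x - d) dk (y - e) f r
       - lam * (\<alpha> - 2) / 2 * (x \<bullet> y + norm e * norm y)
       - \<delta> * (t * ((norm d)\<^sup>2 + (norm y)\<^sup>2) + t\<^sup>2 * (norm e)\<^sup>2)"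
proof -
  define a where "a = \<alpha> - 1 - lam"
  define b where "b = lam * (\<alpha> - 2) / 2"
  define m where "m = min a ((lam - 1) / 4)"
  \<comment> \<open>the sum of the coefficients of the cross terms bounded in \<open>c0\<close> to \<open>c6\<close>\<close>
  define M where "M = b + (lam + 1) / 2 + a / 2 + (\<alpha> - 1) / 4 + 3 / 2 + \<alpha>"
  have pos: "a > 0" "\<alpha> > 2" "b > 0" using lam by (auto simp: a_def b_def)
  have m: "m > 0" "m \<le> a" using lam by (simp_all add: m_def a_def)
  have m': "m \<le> (lam - 1) / 4" unfolding m_def by (rule min.cobounded2)
  have "m / 2 > 0" "0 \<le> lam" using m lam by auto
  from absorb_cross_terms[OF this kap, of M]
  obtain \<delta> T where \<delta>: "\<delta> > 0" and T: "T \<ge> 1" and absorb: "\<And>t D Y e f. t \<ge> T \<Longrightarrow>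
     M * t * (D + Y) * (e + f) + lam / 2 * (D * Y) + (t + 1) / 8 * e\<^sup>2
       - t\<^sup>2 / 8 * (e\<^sup>2 + f\<^sup>2) + \<kappa> / 2 * t\<^sup>2 * (e * f) - m / 2 * (t + 1) * (D\<^sup>2 + Y\<^sup>2)
     \<le> - \<delta> * (t * (D\<^sup>2 + Y\<^sup>2) + t\<^sup>2 * e\<^sup>2)"
    by blast
  have "energy \<alpha> lam (t + 1) x d y e r' \<le> energy \<alpha> lam t (x - d) dk (y - e) f r
       - b * (x \<bullet> y + norm e * norm y)
       - \<delta> * (t * ((norm d)\<^sup>2 + (norm y)\<^sup>2) + t\<^sup>2 * (norm e)\<^sup>2)"
    if t: "t \<ge> T" and rec: "t *\<^sub>R dk = (t + \<alpha>) *\<^sub>R d + (\<alpha> / 2) *\<^sub>R y + t *\<^sub>R e"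
      and mono: "0 \<le> d \<bullet> (e + r' - r)"
      and r: "norm r \<le> \<kappa> * norm f" and r': "norm r' \<le> \<kappa> * norm e"
    for t and x d dk y e f r r' :: 'a
  proof -
    define D Y \<eta> \<phi> where "D = norm d" and "Y = norm y" and "\<eta> = norm e" and "\<phi> = norm f"
    note abbr = D_def[symmetric] Y_def[symmetric] \<eta>_def[symmetric] \<phi>_def[symmetric]
    have nn: "0 \<le> D" "0 \<le> Y" "0 \<le> \<eta>" "0 \<le> \<phi>" by (simp_all add: D_def Y_def \<eta>_def \<phi>_def)
    have t1: "t \<ge> 1" using t T by simp
    have de: "\<bar>d \<bullet> e\<bar> \<le> D * \<eta>" and ye: "\<bar>y \<bullet> e\<bar> \<le> Y * \<eta>" and dy: "\<bar>d \<bullet> y\<bar> \<le> D * Y"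
      unfolding D_def Y_def \<eta>_def by (rule Cauchy_Schwarz_ineq2)+
    have dr': "\<bar>d \<bullet> r'\<bar> \<le> D * (\<kappa> * \<eta>)"
      using Cauchy_Schwarz_ineq2[of d r'] mult_left_mono[OF r' norm_ge_zero[of d]] by (simp add: D_def \<eta>_def)
    have vr: "\<bar>v \<bullet> r\<bar> \<le> norm v * (\<kappa> * \<phi>)" for v
      using Cauchy_Schwarz_ineq2[of v r] mult_left_mono[OF r norm_ge_zero[of v]] by (simp add: \<phi>_def)
    \<comment> \<open>only the part in \<open>e\<close> of the convexity gain is kept\<close>
    have square: "(norm (a *\<^sub>R d + ((\<alpha> - 1) / 2) *\<^sub>R y + (t / 2) *\<^sub>R e))\<^sup>2 / 2
        \<ge> t / 2 * (a * (d \<bullet> e)) + t / 2 * ((\<alpha> - 1) / 2 * (y \<bullet> e)) + t\<^sup>2 / 8 * \<eta>\<^sup>2"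
    proof -
      have "0 \<le> (norm (a *\<^sub>R d + ((\<alpha> - 1) / 2) *\<^sub>R y))\<^sup>2 / 2" by simp
      thus ?thesis unfolding \<eta>_def power2_norm_eq_inner
        by (simp add: inner_simps inner_commute field_simps power2_eq_square)
    qed
    have form: "m / 2 * (t + 1) * (D\<^sup>2 + Y\<^sup>2)
        \<le> (t + 1) * (a * (norm (d + (1/2) *\<^sub>R y))\<^sup>2 + (lam - 1) / 4 * Y\<^sup>2)"
      using mult_left_mono[OF quadratic_coercive[of m a "(lam - 1) / 4" d y], of "t + 1"] m m' t1
      unfolding D_def Y_def by (simp add: mult_ac)
    \<comment> \<open>at order \<open>t\<^sup>2\<close> the term in \<open>\<langle>d, e\<rangle>\<close> is exchanged for the defects, which telescope\<close>
    have mono': "- (t\<^sup>2 / 2 * (d \<bullet> e)) \<le> t\<^sup>2 / 2 * (d \<bullet> r') - t\<^sup>2 / 2 * (d \<bullet> r)"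
      using mult_left_mono[OF mono, of "t\<^sup>2 / 2"] by (simp add: inner_simps distrib_left right_diff_distrib)
    define P where "P = (D + Y) * (\<eta> + \<phi>)"
    have P: "D * \<eta> \<le> P" "Y * \<eta> \<le> P" "D * \<phi> \<le> P" "Y * \<phi> \<le> P" "0 \<le> P"
      using nn by (simp_all add: P_def algebra_simps)
    have kP: "\<kappa> * u \<le> P" if "0 \<le> u" "u \<le> P" for u
      using kap that mult_right_mono[of \<kappa> 1 u] by simp
    have bd: "c * u \<le> c * B" "- (c * u) \<le> c * B" if "\<bar>u\<bar> \<le> B" "0 \<le> c" for c u B :: real
      using mult_left_mono[of u B c] mult_left_mono[of "- u" B c] that by auto
    have deP: "\<bar>d \<bullet> e\<bar> \<le> P" and yeP: "\<bar>y \<bullet> e\<bar> \<le> P" using de ye P by auto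
    have dr'P: "\<bar>d \<bullet> r'\<bar> \<le> P"
      using dr' kP[of "D * \<eta>"] P nn by (simp add: mult_ac)
    have drP: "\<bar>d \<bullet> r\<bar> \<le> P"
      using vr[of d] kP[of "D * \<phi>"] P nn by (simp add: D_def[symmetric] mult_ac)
    have yrP: "\<bar>y \<bullet> r\<bar> \<le> P"
      using vr[of y] kP[of "Y * \<phi>"] P nn by (simp add: Y_def[symmetric] mult_ac)
    have tP: "P \<le> t * P" using P t1 mult_right_mono[of 1 t P] by simp
    have c0: "b * (Y * \<eta>) \<le> b * (t * P)"
      using pos P tP by (intro mult_left_mono) auto
    have c1: "- (t * (lam + 1) / 2 * (d \<bullet> e)) \<le> (lam + 1) / 2 * (t * P)"
      using bd(2)[OF deP, of "t * (lam + 1) / 2"] t1 lam by (simp add: mult_ac)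
    have c2: "- (t / 2 * (a * (d \<bullet> e))) \<le> a / 2 * (t * P)"
      using bd(2)[OF deP, of "t / 2 * a"] t1 pos by (simp add: mult_ac)
    have c3: "- (t / 2 * ((\<alpha> - 1) / 2 * (y \<bullet> e))) \<le> (\<alpha> - 1) / 4 * (t * P)"
      using bd(2)[OF yeP, of "t * (\<alpha> - 1) / 4"] t1 pos by (simp add: mult_ac)
    have c4: "- ((2 * t + 1) / 2 * (d \<bullet> r')) \<le> 3 / 2 * (t * P)"
    proof -
      have "- ((2 * t + 1) / 2 * (d \<bullet> r')) \<le> (2 * t + 1) / 2 * P"
        using bd(2)[OF dr'P] t1 by simp
      thus ?thesis using tP by (simp add: algebra_simps)
    qed
    have c5: "t * \<alpha> / 2 * (d \<bullet> r) \<le> \<alpha> / 2 * (t * P)"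
      using bd(1)[OF drP, of "t * \<alpha> / 2"] t1 pos by (simp add: mult_ac)
    have c6: "t * \<alpha> / 4 * (y \<bullet> r) \<le> \<alpha> / 2 * (t * P)"
    proof -
      have "t * \<alpha> / 4 * (y \<bullet> r) \<le> t * \<alpha> / 4 * P"
        using bd(1)[OF yrP] t1 pos by simp
      also have "\<dots> \<le> t * \<alpha> / 2 * P" using t1 pos P by (intro mult_right_mono) auto
      finally show ?thesis by (simp add: mult_ac)
    qed
    have c7: "t\<^sup>2 / 2 * (e \<bullet> r) \<le> \<kappa> / 2 * t\<^sup>2 * (\<eta> * \<phi>)"
      using bd(1)[OF vr[of e], of "t\<^sup>2 / 2"] by (simp add: \<eta>_def mult_ac)
    have c8: "- (lam / 2 * (d \<bullet> y)) \<le> lam / 2 * (D * Y)"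
      using bd(2)[OF dy] lam by simp
    have c9: "0 \<le> a * lam / 2 * D\<^sup>2" using pos lam by simp
    have split1: "t * (t + lam + 1) / 2 * (d \<bullet> e) = t\<^sup>2 / 2 * (d \<bullet> e) + t * (lam + 1) / 2 * (d \<bullet> e)"
      by (simp add: power2_eq_square field_simps)
    have split2: "(t + 1)\<^sup>2 / 2 * (d \<bullet> r') = t\<^sup>2 / 2 * (d \<bullet> r') + (2 * t + 1) / 2 * (d \<bullet> r')"
      by (simp add: power2_eq_square field_simps)
    have split3: "t / 2 * (((t + \<alpha>) *\<^sub>R d + (\<alpha> / 2) *\<^sub>R y + t *\<^sub>R e) \<bullet> r)
        = t\<^sup>2 / 2 * (d \<bullet> r) + t * \<alpha> / 2 * (d \<bullet> r) + t * \<alpha> / 4 * (y \<bullet> r) + t\<^sup>2 / 2 * (e \<bullet> r)"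
      by (simp add: power2_eq_square inner_simps field_simps)
    have split4: "t\<^sup>2 / 8 * (\<eta>\<^sup>2 + \<phi>\<^sup>2) = t\<^sup>2 / 8 * \<eta>\<^sup>2 + t\<^sup>2 / 8 * \<phi>\<^sup>2"
      by (simp add: distrib_left)
    have MP: "M * t * (D + Y) * (\<eta> + \<phi>) = b * (t * P) + (lam + 1) / 2 * (t * P) + a / 2 * (t * P)
        + (\<alpha> - 1) / 4 * (t * P) + 3 / 2 * (t * P) + \<alpha> / 2 * (t * P) + \<alpha> / 2 * (t * P)"
      by (simp add: M_def P_def field_simps)
    have "energy \<alpha> lam (t + 1) x d y e r' - energy \<alpha> lam t (x - d) dk (y - e) f r
      \<le> - b * (x \<bullet> y) - b * (Y * \<eta>) + (M * t * (D + Y) * (\<eta> + \<phi>) + lam / 2 * (D * Y)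
       + (t + 1) / 8 * \<eta>\<^sup>2 - t\<^sup>2 / 8 * (\<eta>\<^sup>2 + \<phi>\<^sup>2) + \<kappa> / 2 * t\<^sup>2 * (\<eta> * \<phi>)
       - m / 2 * (t + 1) * (D\<^sup>2 + Y\<^sup>2))"
      unfolding energy_difference[OF rec] a_def[symmetric] b_def[symmetric] abbr split1 split2 split3 MP
      using c0 c1 c2 c3 c4 c5 c6 c7 c8 c9 mono' square form split4
      by linarith
    also have "\<dots> \<le> - b * (x \<bullet> y) - b * (Y * \<eta>)
        + (- \<delta> * (t * (D\<^sup>2 + Y\<^sup>2) + t\<^sup>2 * \<eta>\<^sup>2))"
      using absorb[OF t, of D Y \<eta> \<phi>] by (intro add_left_mono)
    finally show ?thesis unfolding abbr by (simp add: algebra_simps)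
  qed
  thus ?thesis using \<delta> unfolding b_def by blast
qed

section \<open>Convergence of the algorithm\<close>

text \<open>
  The step size condition takes the form \<open>s L < 1/2\<close> in which it is used: it keeps the bound
  \<open>s L |e|\<close> on the defect below half of \<open>|e|\<close>.
\<close>

locale fast_ogda =
  fixes V :: "'a::real_inner \<Rightarrow> 'a" and L \<alpha> s :: real and z zb :: "nat \<Rightarrow> 'a"
  assumes mono: "monotone_operator V" and lip: "L-lipschitz_on UNIV V"
    and alpha: "\<alpha> > 2" and s_pos: "0 < s" and step_size: "s * L < 1 / 2"
    and alg: "explicit_fast_ogda V \<alpha> s z zb"
begin

text \<open>
  The index of \<open>y\<close> is shifted by one against that of \<open>zb\<close>, because \<open>z\<^sub>k\<^sub>+\<^sub>1\<close> is obtained from \<open>zb\<^sub>k\<close> by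
  a small correction, so that \<open>V (zb k)\<close> approximates \<open>V (z (k + 1))\<close>.
\<close>

definition y :: "nat \<Rightarrow> 'a" where "y k = s *\<^sub>R V (zb (k - 1))"
definition d :: "nat \<Rightarrow> 'a" where "d k = z k - z (k - 1)"
definition e :: "nat \<Rightarrow> 'a" where "e k = y k - y (k - 1)"
definition r :: "nat \<Rightarrow> 'a" where "r k = s *\<^sub>R V (z k) - y k"
definition E :: "real \<Rightarrow> 'a \<Rightarrow> nat \<Rightarrow> real" where
  "E lam w k = energy \<alpha> lam (real k) (z k - w) (d k) (y k) (e k) (r k)"

lemma L_nonneg: "0 \<le> L" using lip by (rule lipschitz_on_nonneg)

lemma monotoneD: "0 \<le> (u - v) \<bullet> (V u - V v)"
  using mono by (simp add: monotone_operator_def)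

lemma correction:
  assumes "1 \<le> k"
  shows "z (Suc k) = zb k - ((1 + real k / (real k + \<alpha>)) / 2) *\<^sub>R e (Suc k)"
  using alg assms by (simp add: explicit_fast_ogda_def e_def y_def scaleR_diff_right mult_ac)

lemma recurrence:
  assumes k: "1 \<le> k"
  shows "real k *\<^sub>R d k
    = (real k + \<alpha>) *\<^sub>R d (Suc k) + (\<alpha> / 2) *\<^sub>R y (Suc k) + real k *\<^sub>R e (Suc k)"
proof -
  define n where "n = real k + \<alpha>"
  have n: "n \<noteq> 0" "real k = n - \<alpha>" using alpha by (auto simp: n_def)
  have "z (Suc k) = z k + (real k / n) *\<^sub>R d k - (\<alpha> / (2 * n)) *\<^sub>R y k
     - ((1 + real k / n) / 2) *\<^sub>R e (Suc k)"
  proof -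
    have "1 - \<alpha> / n = real k / n" using n by (simp add: field_simps)
    moreover have "zb k = z k + (1 - \<alpha> / n) *\<^sub>R d k - (\<alpha> / (2 * n)) *\<^sub>R y k"
      using alg k by (simp add: explicit_fast_ogda_def y_def d_def n_def)
    ultimately show ?thesis unfolding correction[OF k] n_def[symmetric] by simp
  qed
  hence "n *\<^sub>R d (Suc k) = n *\<^sub>R ((real k / n) *\<^sub>R d k - (\<alpha> / (2 * n)) *\<^sub>R y k
     - ((1 + real k / n) / 2) *\<^sub>R e (Suc k))"
    by (simp add: d_def)
  also have "\<dots> = real k *\<^sub>R d k - (\<alpha> / 2) *\<^sub>R y k - ((n + real k) / 2) *\<^sub>R e (Suc k)"
    using n(1) by (simp add: scaleR_diff_right field_simps)
  also have "\<dots> = real k *\<^sub>R d k - (\<alpha> / 2) *\<^sub>R y (Suc k) - real k *\<^sub>R e (Suc k)"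
  proof -
    have n: "(n + real k) / 2 = \<alpha> / 2 + real k" by (simp add: n_def)
    show ?thesis unfolding n e_def by (simp add: scaleR_add_left scaleR_diff_right)
  qed
  finally show ?thesis by (simp add: n_def)
qed

lemma correction_weight: "0 \<le> (1 + real k / (real k + \<alpha>)) / 2" "(1 + real k / (real k + \<alpha>)) / 2 \<le> 1"
  using alpha by (simp_all add: field_simps)

text \<open>
  By \<open>correction\<close>, \<open>z\<^sub>k\<^sub>+\<^sub>1\<close> and \<open>zb\<^sub>k\<close> differ by at most \<open>|e\<^sub>k\<^sub>+\<^sub>1|\<close>, since the weight lies between
  0 and 1.
\<close>

lemma r_bound:
  assumes k: "1 \<le> k"
  shows "norm (r (Suc k)) \<le> s * L * norm (e (Suc k))"
proof -
  have "norm (r (Suc k)) = s * dist (V (z (Suc k))) (V (zb k))"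
    using s_pos by (simp add: r_def y_def dist_norm flip: scaleR_diff_right)
  also have "\<dots> \<le> s * (L * dist (z (Suc k)) (zb k))"
    using s_pos lipschitz_onD[OF lip] by (intro mult_left_mono) auto
  also have "dist (z (Suc k)) (zb k) = (1 + real k / (real k + \<alpha>)) / 2 * norm (e (Suc k))"
    unfolding correction[OF k] dist_norm using correction_weight(1)[of k] by simp
  also have "s * (L * \<dots>) \<le> s * (L * (1 * norm (e (Suc k))))"
    using s_pos L_nonneg correction_weight(2)[of k] by (intro mult_left_mono mult_right_mono) auto
  finally show ?thesis by simp
qed

text \<open>
  The monotonicity inequality at \<open>zb\<^sub>k\<close>, transported to \<open>z\<^sub>k\<^sub>+\<^sub>1\<close> by means of \<open>correction\<close>.
\<close>

lemma almost_monotone: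
  assumes k: "1 \<le> k" and w: "V w = 0"
  shows "0 \<le> (z (Suc k) - w) \<bullet> y (Suc k) + norm (e (Suc k)) * norm (y (Suc k))"
proof -
  define \<theta> where "\<theta> = (1 + real k / (real k + \<alpha>)) / 2"
  have "0 \<le> s * ((zb k - w) \<bullet> (V (zb k) - V w))" using s_pos monotoneD by simp
  also have "\<dots> = (z (Suc k) - w) \<bullet> y (Suc k) + \<theta> * (e (Suc k) \<bullet> y (Suc k))"
    unfolding correction[OF k] \<theta>_def[symmetric] by (simp add: w y_def[of "Suc k"] inner_simps algebra_simps)
  also have "\<theta> * (e (Suc k) \<bullet> y (Suc k)) \<le> \<theta> * (norm (e (Suc k)) * norm (y (Suc k)))"
    unfolding \<theta>_def by (intro mult_left_mono norm_cauchy_schwarz correction_weight)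
  also have "\<dots> \<le> 1 * (norm (e (Suc k)) * norm (y (Suc k)))"
    unfolding \<theta>_def by (intro mult_right_mono correction_weight) auto
  finally show ?thesis by simp
qed

lemma E_lower_bound:
  assumes k: "2 \<le> k" and w: "V w = 0" and lam: "0 \<le> lam"
  shows "(norm (lam *\<^sub>R (z k - w) + real k *\<^sub>R d k))\<^sup>2 / 8
       + (norm (lam *\<^sub>R (z k - w) + real k *\<^sub>R d k + real k *\<^sub>R y k))\<^sup>2 / 4
       + lam * (\<alpha> - 1 - lam) / 2 * (norm (z k - w))\<^sup>2 \<le> E lam w k"
  unfolding E_def
proof (rule energy_lower_bound)
  obtain j where j: "k = Suc j" "1 \<le> j" using k by (cases k) auto
  have "norm (r k) \<le> s * L * norm (e k)" using r_bound[OF j(2)] j by simp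
  also have "\<dots> \<le> 1 / 2 * norm (e k)" using step_size by (intro mult_right_mono) auto
  finally show "norm (r k) \<le> norm (e k) / 2" by simp
  show "0 \<le> (z k - w) \<bullet> (y k + r k)"
    using monotoneD[of "z k" w] w s_pos by (simp add: r_def)
qed (use lam in auto)

lemma E_descent:
  assumes w: "V w = 0" and lam: "1 < lam" "lam < \<alpha> - 1"
  shows "\<exists>\<delta>>0. \<forall>\<^sub>F k in sequentially. E lam w (Suc k) \<le> E lam w k
     - (lam * (\<alpha> - 2) / 2 * ((z (Suc k) - w) \<bullet> y (Suc k) + norm (e (Suc k)) * norm (y (Suc k)))
     + \<delta> * (real k * ((norm (d (Suc k)))\<^sup>2 + (norm (y (Suc k)))\<^sup>2) + (real k)\<^sup>2 * (norm (e (Suc k)))\<^sup>2))"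
proof -
  have kap: "0 \<le> s * L" "s * L < 1 / 2" using s_pos L_nonneg step_size by auto
  from energy_descent[OF lam kap, where ?'a = 'a] obtain \<delta> T where \<delta>: "\<delta> > 0" and desc:
    "\<And>t x d dk y e f r r' :: 'a. t \<ge> T \<Longrightarrow>
     t *\<^sub>R dk = (t + \<alpha>) *\<^sub>R d + (\<alpha> / 2) *\<^sub>R y + t *\<^sub>R e \<Longrightarrow>
     0 \<le> d \<bullet> (e + r' - r) \<Longrightarrow> norm r \<le> s * L * norm f \<Longrightarrow> norm r' \<le> s * L * norm e \<Longrightarrow>
     energy \<alpha> lam (t + 1) x d y e r' \<le> energy \<alpha> lam t (x - d) dk (y - e) f r
       - lam * (\<alpha> - 2) / 2 * (x \<bullet> y + norm e * norm y)
       - \<delta> * (t * ((norm d)\<^sup>2 + (norm y)\<^sup>2) + t\<^sup>2 * (norm e)\<^sup>2)"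
    by metis
  show ?thesis
  proof (intro exI[of _ \<delta>] conjI \<delta>)
    \<comment> \<open>the bound on \<open>r\<close> is needed at the old index as well, hence \<open>k \<ge> 2\<close>\<close>
    have "\<forall>\<^sub>F k in sequentially. T \<le> real k \<and> 2 \<le> k"
      using eventually_ge_at_top[of "nat \<lceil>T\<rceil>"] eventually_ge_at_top[of 2]
      by eventually_elim linarith
    thus "\<forall>\<^sub>F k in sequentially. E lam w (Suc k) \<le> E lam w k
     - (lam * (\<alpha> - 2) / 2 * ((z (Suc k) - w) \<bullet> y (Suc k) + norm (e (Suc k)) * norm (y (Suc k)))
     + \<delta> * (real k * ((norm (d (Suc k)))\<^sup>2 + (norm (y (Suc k)))\<^sup>2) + (real k)\<^sup>2 * (norm (e (Suc k)))\<^sup>2))"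
    proof eventually_elim
      case (elim k)
      then obtain j where j: "k = Suc j" "1 \<le> j" by (cases k) auto
      have "0 \<le> s * (d (Suc k) \<bullet> (V (z (Suc k)) - V (z k)))"
        using s_pos monotoneD by (simp add: d_def)
      also have "\<dots> = d (Suc k) \<bullet> (e (Suc k) + r (Suc k) - r k)"
        by (simp add: e_def r_def inner_simps algebra_simps)
      finally have m: "0 \<le> d (Suc k) \<bullet> (e (Suc k) + r (Suc k) - r k)" .
      have rk: "norm (r k) \<le> s * L * norm (e k)" using r_bound[OF j(2)] j by simp
      have rk': "norm (r (Suc k)) \<le> s * L * norm (e (Suc k))" using r_bound[of k] elim by simp
      have "z (Suc k) - w - d (Suc k) = z k - w" "y (Suc k) - e (Suc k) = y k"
        by (simp_all add: d_def e_def)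
      with desc[of "real k" "d k" "d (Suc k)" "y (Suc k)" "e (Suc k)" "r (Suc k)" "r k" "e k" "z (Suc k) - w",
            OF _ recurrence m rk rk'] elim
      show ?case by (simp add: E_def add.commute)
    qed
  qed
qed

text \<open>
  Summing the descent gives convergence of the series of \<open>\<langle>x, y\<rangle> + |e| |y|\<close> and of the squares; the
  product \<open>|e| |y|\<close> is summable on its own because it is dominated by the squares.
\<close>

lemma E_convergence:
  assumes w: "V w = 0" and lam: "1 < lam" "lam < \<alpha> - 1"
  shows "convergent (E lam w)" "summable (\<lambda>k. (z (Suc k) - w) \<bullet> y (Suc k))"
proof -
  define p where "p k = (z (Suc k) - w) \<bullet> y (Suc k) + norm (e (Suc k)) * norm (y (Suc k))" for k
  define q where "q k = real k * ((norm (d (Suc k)))\<^sup>2 + (norm (y (Suc k)))\<^sup>2)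
     + (real k)\<^sup>2 * (norm (e (Suc k)))\<^sup>2" for k
  define b where "b = lam * (\<alpha> - 2) / 2"
  have b: "b > 0" using lam alpha by (simp add: b_def)
  obtain \<delta> where \<delta>: "\<delta> > 0"
    and desc: "\<forall>\<^sub>F k in sequentially. E lam w (Suc k) \<le> E lam w k - (b * p k + \<delta> * q k)"
    using E_descent[OF w lam] unfolding p_def q_def b_def by blast
  have p: "\<forall>\<^sub>F k in sequentially. 0 \<le> p k"
    using eventually_ge_at_top[of 1] by eventually_elim (use almost_monotone[OF _ w] in \<open>simp add: p_def\<close>)
  have q: "0 \<le> q k" for k by (simp add: q_def)
  have "\<forall>\<^sub>F k in sequentially. 0 \<le> E lam w k"
    using eventually_ge_at_top[of 2]
  proof eventually_elim
    case (elim k)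
    have "0 \<le> lam * (\<alpha> - 1 - lam) / 2 * (norm (z k - w))\<^sup>2" using lam by simp
    moreover have "0 \<le> (norm (lam *\<^sub>R (z k - w) + real k *\<^sub>R d k))\<^sup>2 / 8"
      "0 \<le> (norm (lam *\<^sub>R (z k - w) + real k *\<^sub>R d k + real k *\<^sub>R y k))\<^sup>2 / 4" by simp_all
    ultimately show ?case using E_lower_bound[OF elim w, of lam] lam by linarith
  qed
  moreover have "\<forall>\<^sub>F k in sequentially. 0 \<le> b * p k + \<delta> * q k"
    using p by eventually_elim (use b q \<delta> in simp)
  note lyapunov = lyapunov_convergence[OF calculation this desc]
  have conv: "convergent (E lam w)" and sum: "summable (\<lambda>k. b * p k + \<delta> * q k)"
    by (fact lyapunov)+
  show "convergent (E lam w)" by (rule conv)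
  have "\<forall>\<^sub>F k in sequentially. norm (b * p k) \<le> b * p k + \<delta> * q k"
    using p by eventually_elim (use b q \<delta> in simp)
  hence "summable (\<lambda>k. b * p k)" by (rule summable_comparison_test_ev[OF _ sum])
  hence sp: "summable p" using b by (simp add: summable_cmult_iff)
  have "\<forall>\<^sub>F k in sequentially. norm (\<delta> * q k) \<le> b * p k + \<delta> * q k"
    using p by eventually_elim (use b q \<delta> in simp)
  hence "summable (\<lambda>k. \<delta> * q k)" by (rule summable_comparison_test_ev[OF _ sum])
  hence sq: "summable q" using \<delta> by (simp add: summable_cmult_iff)
  have "summable (\<lambda>k. norm (e (Suc k)) * norm (y (Suc k)))"
  proof (rule summable_comparison_test_ev[OF _ sq])
    show "\<forall>\<^sub>F k in sequentially. norm (norm (e (Suc k)) * norm (y (Suc k))) \<le> q k"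
      using eventually_ge_at_top[of 1]
    proof eventually_elim
      case (elim k)
      have "norm (e (Suc k)) * norm (y (Suc k)) \<le> (norm (y (Suc k)))\<^sup>2 + (norm (e (Suc k)))\<^sup>2"
        using sum_squares_bound[of "norm (e (Suc k))" "norm (y (Suc k))"]
          mult_nonneg_nonneg[OF norm_ge_zero[of "e (Suc k)"] norm_ge_zero[of "y (Suc k)"]] by linarith
      also have "\<dots> \<le> real k * (norm (y (Suc k)))\<^sup>2 + (real k)\<^sup>2 * (norm (e (Suc k)))\<^sup>2"
        using elim mult_right_mono[of 1 "real k" "(norm (y (Suc k)))\<^sup>2"]
          mult_right_mono[of 1 "(real k)\<^sup>2" "(norm (e (Suc k)))\<^sup>2"] by simp
      also have "\<dots> \<le> q k" by (simp add: q_def distrib_left)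
      finally show ?case by simp
    qed
  qed
  from summable_diff[OF sp this] show "summable (\<lambda>k. (z (Suc k) - w) \<bullet> y (Suc k))"
    by (simp add: p_def)
qed

text \<open>
  The squares in \<open>E_lower_bound\<close> bound \<open>x\<close>, \<open>\<lambda>x + k d\<close> and \<open>\<lambda>x + k d + k y\<close>; \<open>k d\<close> and \<open>k y\<close> are
  differences of these vectors.
\<close>

lemma scaled_bounds:
  assumes w: "V w = 0"
  shows "\<exists>B. \<forall>k\<ge>2. norm (real k *\<^sub>R d k) \<le> B \<and> norm (real k *\<^sub>R y k) \<le> B"
proof -
  \<comment> \<open>the midpoint of the interval of admissible weights\<close>
  define lam where "lam = \<alpha> / 2"
  have lam: "1 < lam" "lam < \<alpha> - 1" using alpha by (auto simp: lam_def)
  define c where "c = lam * (\<alpha> - 1 - lam) / 2"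
  have c: "c > 0" using lam by (simp add: c_def)
  have "Bseq (E lam w)" using E_convergence(1)[OF w lam] by (rule convergent_imp_Bseq)
  then obtain C where C: "\<And>k. \<bar>E lam w k\<bar> \<le> C" by (auto simp: Bseq_def)
  define B1 B2 B3 where "B1 = sqrt (8 * C)" and "B2 = sqrt (4 * C)" and "B3 = sqrt (C / c)"
  have "norm (real k *\<^sub>R d k) \<le> B1 + B2 + lam * B3 \<and> norm (real k *\<^sub>R y k) \<le> B1 + B2 + lam * B3"
    if k: "k \<ge> 2" for k
  proof -
    define x X Y where "x = z k - w" and "X = lam *\<^sub>R x + real k *\<^sub>R d k" and "Y = X + real k *\<^sub>R y k"
    have "(norm X)\<^sup>2 / 8 + (norm Y)\<^sup>2 / 4 + c * (norm x)\<^sup>2 \<le> C"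
      using E_lower_bound[OF k w, of lam] C[of k] lam unfolding X_def Y_def x_def c_def by simp
    moreover have "0 \<le> (norm X)\<^sup>2 / 8" "0 \<le> (norm Y)\<^sup>2 / 4" "0 \<le> c * (norm x)\<^sup>2" using c by simp_all
    ultimately have "(norm X)\<^sup>2 \<le> 8 * C" "(norm Y)\<^sup>2 \<le> 4 * C" "c * (norm x)\<^sup>2 \<le> C" by linarith+
    hence b: "norm X \<le> B1" "norm Y \<le> B2" "norm x \<le> B3"
      using c unfolding B1_def B2_def B3_def by (auto intro!: real_le_rsqrt simp: field_simps)
    have "norm (real k *\<^sub>R d k) \<le> norm X + lam * norm x"
      using norm_triangle_ineq4[of X "lam *\<^sub>R x"] lam by (simp add: X_def)
    moreover have "norm (real k *\<^sub>R y k) \<le> norm Y + norm X"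
      using norm_triangle_ineq4[of Y X] by (simp add: Y_def)
    moreover have "lam * norm x \<le> lam * B3" "0 \<le> lam * norm x" using b lam by auto
    moreover have "0 \<le> norm X" "0 \<le> norm Y" by simp_all
    ultimately show ?thesis using b by linarith
  qed
  thus ?thesis by blast
qed

lemma residual_tendsto_zero:
  assumes w: "V w = 0"
  shows "(\<lambda>k. V (z k)) \<longlonglongrightarrow> 0"
proof -
  obtain B where "\<And>k. k \<ge> 2 \<Longrightarrow> norm (real k *\<^sub>R y k) \<le> B" using scaled_bounds[OF w] by blast
  hence y0: "y \<longlonglongrightarrow> 0" by (rule tendsto_zero_of_scaled_bound)
  have ySuc: "(\<lambda>k. y (Suc k)) \<longlonglongrightarrow> 0" using y0 by (rule LIMSEQ_Suc)
  have "(\<lambda>k. y (Suc k) - y k) \<longlonglongrightarrow> 0 - 0" using ySuc y0 by (rule tendsto_diff)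
  hence "(\<lambda>k. e (Suc k)) \<longlonglongrightarrow> 0" by (simp add: e_def)
  hence "(\<lambda>k. s * L * norm (e (Suc k))) \<longlonglongrightarrow> s * L * norm (0::'a)" by (intro tendsto_intros)
  hence bound0: "(\<lambda>k. s * L * norm (e (Suc k))) \<longlonglongrightarrow> 0" by simp
  have "\<forall>\<^sub>F k in sequentially. norm (r (Suc k)) \<le> s * L * norm (e (Suc k))"
    using eventually_ge_at_top[of 1] by eventually_elim (rule r_bound)
  hence "(\<lambda>k. r (Suc k)) \<longlonglongrightarrow> 0" using bound0 by (rule Lim_null_comparison)
  from tendsto_scaleR[OF tendsto_const[of "inverse s"] tendsto_add[OF this ySuc]]
  have "(\<lambda>k. V (z (Suc k))) \<longlonglongrightarrow> 0" using s_pos by (simp add: r_def)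
  thus ?thesis by (rule LIMSEQ_imp_Suc)
qed

text \<open>
  With \<open>g = 1/2 |z - w|^2\<close> and \<open>S\<close> the partial sums of \<open>\<langle>z - w, y\<rangle>\<close>, the quantity isolated by
  \<open>energy_affine\<close> is \<open>(\<alpha> - 1) g + k (\<Delta>g + \<Delta>S)\<close> up to the vanishing term \<open>k/2 |d|^2\<close>.  Adding
  \<open>(\<alpha> - 1) S\<close> brings it into the form required by \<open>averaging_limit\<close> for \<open>q = g + S\<close>.
\<close>

lemma distance_convergent:
  assumes w: "V w = 0"
  shows "convergent (\<lambda>k. (norm (z k - w))\<^sup>2)"
proof -
  \<comment> \<open>two distinct weights in the open interval from \<open>1\<close> to \<open>\<alpha> - 1\<close>\<close>
  define lam mu where "lam = \<alpha> / 2" and "mu = 1 / 2 + \<alpha> / 4"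
  have lam: "1 < lam" "lam < \<alpha> - 1" and mu: "1 < mu" "mu < \<alpha> - 1" and ne: "lam - mu \<noteq> 0"
    using alpha by (auto simp: lam_def mu_def)
  define x where "x k = z k - w" for k
  define g where "g k = (norm (x k))\<^sup>2 / 2" for k
  define S where "S k = (\<Sum>i<k. x (Suc i) \<bullet> y (Suc i))" for k
  define \<phi> where "\<phi> k = (\<alpha> - 1) * g k + real k * (x k \<bullet> (d k + y k))" for k
  have "E lam w k - E mu w k = (lam - mu) * \<phi> k" for k
    unfolding E_def energy_affine \<phi>_def g_def x_def by simp
  hence phi_eq: "\<phi> = (\<lambda>k. (E lam w k - E mu w k) / (lam - mu))"
    using ne by (intro ext) (metis nonzero_mult_div_cancel_left)
  obtain la lb where lims: "E lam w \<longlonglongrightarrow> la" "E mu w \<longlonglongrightarrow> lb"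
    using E_convergence(1)[OF w lam] E_convergence(1)[OF w mu] by (auto simp: convergent_def)
  have phi: "\<phi> \<longlonglongrightarrow> (la - lb) / (lam - mu)"
    unfolding phi_eq using lims ne by (intro tendsto_divide tendsto_diff tendsto_const)
  have "summable (\<lambda>i. x (Suc i) \<bullet> y (Suc i))"
    using E_convergence(2)[OF w lam] by (simp add: x_def)
  then obtain S' where S: "S \<longlonglongrightarrow> S'"
    unfolding S_def using summable_LIMSEQ by blast
  obtain B where B: "\<And>k. k \<ge> 2 \<Longrightarrow> norm (real k *\<^sub>R d k) \<le> B" using scaled_bounds[OF w] by blast
  have kd: "(\<lambda>k. real k * (norm (d k))\<^sup>2) \<longlonglongrightarrow> 0"
  proof (rule tendsto_zero_of_scaled_bound)
    fix k :: nat assume "k \<ge> 2"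
    have "norm (real k *\<^sub>R (real k * (norm (d k))\<^sup>2)) = (norm (real k *\<^sub>R d k))\<^sup>2"
      by (simp add: power2_eq_square)
    also have "\<dots> \<le> B\<^sup>2" using B[OF \<open>k \<ge> 2\<close>] by (intro power_mono) auto
    finally show "norm (real k *\<^sub>R (real k * (norm (d k))\<^sup>2)) \<le> B\<^sup>2" .
  qed
  have difference_form: "(\<alpha> - 1) * (g (Suc k) + S (Suc k)) + real (Suc k) * ((g (Suc k) + S (Suc k)) - (g k + S k))
      = \<phi> (Suc k) + (\<alpha> - 1) * S (Suc k) - real (Suc k) * (norm (d (Suc k)))\<^sup>2 / 2" for k
  proof -
    define A where "A = x (Suc k) \<bullet> (d (Suc k) + y (Suc k))"
    define D where "D = (norm (d (Suc k)))\<^sup>2"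
    have xk: "x k = x (Suc k) - d (Suc k)" by (simp add: x_def d_def)
    have "g (Suc k) - g k = x (Suc k) \<bullet> d (Suc k) - D / 2"
      unfolding g_def xk D_def power2_norm_eq_inner by (simp add: inner_simps inner_commute field_simps)
    moreover have "S (Suc k) = S k + x (Suc k) \<bullet> y (Suc k)" by (simp add: S_def)
    ultimately have diff: "(g (Suc k) + S (Suc k)) - (g k + S k) = A - D / 2"
      unfolding A_def inner_add_right by linarith
    have \<phi>: "\<phi> (Suc k) = (\<alpha> - 1) * g (Suc k) + real (Suc k) * A" by (simp only: \<phi>_def A_def)
    show ?thesis unfolding diff \<phi> D_def[symmetric] distrib_left right_diff_distrib by simp
  qed
  define l where "l = (la - lb) / (lam - mu) + (\<alpha> - 1) * S' - 0 / 2"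
  have "(\<lambda>k. \<phi> (Suc k) + (\<alpha> - 1) * S (Suc k) - real (Suc k) * (norm (d (Suc k)))\<^sup>2 / 2) \<longlonglongrightarrow> l"
    unfolding l_def
    by (intro tendsto_diff tendsto_add tendsto_mult_left LIMSEQ_Suc[OF phi] LIMSEQ_Suc[OF S]
        tendsto_divide[OF LIMSEQ_Suc[OF kd] tendsto_const]) simp
  hence avg: "(\<lambda>k. (\<alpha> - 1) * (g (Suc k) + S (Suc k))
      + real (Suc k) * ((g (Suc k) + S (Suc k)) - (g k + S k))) \<longlonglongrightarrow> l"
    by (simp only: difference_form)
  have "1 \<le> \<alpha> - 1" using alpha by simp
  from averaging_limit[OF this avg]
  have "(\<lambda>k. g k + S k) \<longlonglongrightarrow> l / (\<alpha> - 1)" .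
  from tendsto_mult[OF tendsto_const[of 2] tendsto_diff[OF this S]]
  have "(\<lambda>k. (norm (z k - w))\<^sup>2) \<longlonglongrightarrow> 2 * (l / (\<alpha> - 1) - S')"
    by (simp add: g_def x_def)
  thus ?thesis by (rule convergentI)
qed

end

theorem theorem16:
  fixes V :: "'a::{real_inner, complete_space} \<Rightarrow> 'a"
    and z zb :: "nat \<Rightarrow> 'a"
    and L \<alpha> s :: real
  assumes "monotone_operator V"
    and "L > 0"
    and "L-lipschitz_on UNIV V"
    and "{w. V w = 0} \<noteq> {}"
    and "\<alpha> > 2"
    and "0 < s"
    and "s < 1 / (2 * L)"
    and "explicit_fast_ogda V \<alpha> s z zb"
  shows "\<exists>w. V w = 0 \<and> weakly_converges_to z w"
proof -
  have "s * L < 1 / 2" using assms(2,7) by (simp add: field_simps)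
  then interpret fast_ogda V L \<alpha> s z zb
    using assms by unfold_locales
  obtain p where p: "V p = 0" using assms(4) by blast
  show ?thesis
  proof (rule opial_monotone[OF mono])
    show "continuous_on UNIV V" using lip by (rule lipschitz_on_continuous_on)
  qed (use p distance_convergent residual_tendsto_zero in auto)
qed

end
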